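(* For every integer $n\ge 2$ and every complex root $\alpha_n$ of $f_{1,n}(x)=x^{n-1}+2x^{n-2}+3x^{n-3}+\cdots+(n-1)x+n$, one has $1\leq |\alpha_n|<(n+1)^{2/n}$. In particular, for any choice of a root $\alpha_n$ of $f_{1,n}(x)$ for each $n\ge 2$, $|\alpha_n|\to 1$ as $n\to\infty$.
   Context: For a positive integer $n$, $f_{1,n}(x)=\sum_{k=1}^{n} k\,x^{n-k}\in\mathbb{Z}[x]$, a monic polynomial of degree $n-1$. *)

theory Defs
  imports Complex_Main "HOL-Computational_Algebra.Polynomial"
begin

definition f1 :: "nat \<Rightarrow> int poly" where
  "f1 n = (\<Sum>k=1..n. monom (int k) (n - k))"

definition complex_root :: "int poly \<Rightarrow> complex \<Rightarrow> bool" where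
  "complex_root p z \<longleftrightarrow> poly (map_poly of_int p) z = 0"

end

theory Submission
  imports Defs "HOL-Real_Asymp.Real_Asymp"
begin

text \<open>Multiplying \<open>f\<^sub>1\<^sub>,\<^sub>n(z) = 0\<close> by \<open>z - 1\<close> gives \<open>z + z\<^sup>2 + \<dots> + z\<^sup>n = n\<close>, which is
  impossible for \<open>|z| < 1\<close>. Multiplying by \<open>z - 1\<close> once more gives \<open>z\<^sup>n\<^sup>+\<^sup>1 = (n + 1) z - n\<close>,
  so \<open>|z|\<^sup>n \<le> 2 n + 1 < (n + 1)\<^sup>2\<close> because \<open>|z| \<ge> 1\<close>.\<close>

lemma poly_f1: "poly (map_poly of_int (f1 n)) (z::complex) = (\<Sum>k=1..n. of_nat k * z ^ (n - k))"
proof -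
  have "map_poly of_int (f1 n) = (\<Sum>k=1..n. monom (of_nat k :: complex) (n - k))"
    by (rule poly_eqI) (auto simp: f1_def coeff_map_poly coeff_sum intro!: sum.cong)
  then show ?thesis
    by (simp add: poly_sum poly_monom)
qed

text \<open>Consecutive coefficients differ by 1, so multiplying by \<open>z - 1\<close> leaves only
  unit coefficients and a constant. The induction uses the Horner recursion: passing from
  \<open>n\<close> to \<open>Suc n\<close> multiplies the sum by \<open>z\<close> and adds the
  constant term \<open>Suc n\<close>.\<close>

lemma sum_mult_power_diff_telescope:
  fixes z :: "'a::comm_ring_1"
  shows "(z - 1) * (\<Sum>k=1..n. of_nat k * z ^ (n - k)) = (\<Sum>i=1..n. z ^ i) - of_nat n"
proof (induction n)
  case (Suc n)
  have "(\<Sum>k=1..n. of_nat k * z ^ (Suc n - k)) = z * (\<Sum>k=1..n. of_nat k * z ^ (n - k))"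
    by (auto simp: sum_distrib_left Suc_diff_le mult_ac intro!: sum.cong)
  then have "(z - 1) * (\<Sum>k=1..Suc n. of_nat k * z ^ (Suc n - k))
      = z * ((z - 1) * (\<Sum>k=1..n. of_nat k * z ^ (n - k))) + (z - 1) * of_nat (Suc n)"
    by (simp add: algebra_simps)
  also have "\<dots> = z * (\<Sum>i=1..n. z ^ i) - z * of_nat n + (z - 1) * of_nat (Suc n)"
    by (simp only: Suc.IH right_diff_distrib)
  also have "z * (\<Sum>i=1..n. z ^ i) = (\<Sum>i=1..Suc n. z ^ i) - z"
  proof -
    have "(\<Sum>i=1..Suc n. z ^ i) = z + (\<Sum>i=Suc 1..Suc n. z ^ i)"
      by (simp add: sum.atLeast_Suc_atMost)
    also have "(\<Sum>i=Suc 1..Suc n. z ^ i) = z * (\<Sum>i=1..n. z ^ i)"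
      unfolding sum.shift_bounds_cl_Suc_ivl by (simp add: sum_distrib_left)
    finally show ?thesis by simp
  qed
  \<comment> \<open>The remaining terms \<open>- z - z * n + (z - 1) * (n + 1)\<close> collapse to
    \<open>- (n + 1)\<close>.\<close>
  finally show ?case by (simp add: algebra_simps)
qed simp

lemma f1_root_sum_powers:
  assumes "complex_root (f1 n) z"
  shows "(\<Sum>i=1..n. z ^ i) = of_nat n"
  using sum_mult_power_diff_telescope[of z n] assms by (simp add: complex_root_def poly_f1)

lemma f1_root_power_Suc:
  assumes "complex_root (f1 n) z"
  shows "z ^ Suc n = of_nat (Suc n) * z - of_nat n"
proof -
  have "(1 - z) * (\<Sum>i=1..n. z ^ i) = z - z ^ Suc n"
  proof (cases "n = 0")
    case False
    then have "1 \<le> n" by simp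
    from sum_gp_multiplied[OF this, of z] show ?thesis by (simp only: power_one_right)
  qed simp
  then show ?thesis
    unfolding f1_root_sum_powers[OF assms] by (simp add: algebra_simps)
qed

text \<open>By the triangle inequality the \<open>n\<close> powers of \<open>cmod z\<close> sum to
  at least \<open>n\<close>, so they cannot all be below 1. The case \<open>n = 0\<close> is
  excluded because \<open>f1 0\<close> is the zero polynomial, which vanishes everywhere.\<close>

lemma cmod_f1_root_ge_1:
  assumes "n \<ge> 1" "complex_root (f1 n) z"
  shows "1 \<le> cmod z"
proof (rule ccontr)
  assume "\<not> 1 \<le> cmod z"
  then have "(\<Sum>i=1..n. cmod z ^ i) < (\<Sum>i=1..n. 1)"
    using assms(1) by (intro sum_strict_mono) (auto simp: power_less_one_iff)
  moreover have "real n \<le> (\<Sum>i=1..n. cmod z ^ i)"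
    using norm_sum[of "\<lambda>i. z ^ i" "{1..n}"] f1_root_sum_powers[OF assms(2)]
    by (simp add: norm_power)
  ultimately show False by simp
qed

lemma cmod_f1_root_less:
  assumes "n \<ge> 1" "complex_root (f1 n) z"
  shows "cmod z < (real n + 1) powr (2 / real n)"
proof -
  have ge: "1 \<le> cmod z" by (rule cmod_f1_root_ge_1[OF assms])
  have "cmod z ^ n * cmod z = cmod (of_nat (Suc n) * z - of_nat n)"
    using f1_root_power_Suc[OF assms(2)] by (metis norm_power power_Suc2)
  also have "\<dots> \<le> real (Suc n) * cmod z + real n"
    using norm_triangle_ineq4[of "of_nat (Suc n) * z" "of_nat n"]
    by (simp only: norm_mult norm_of_nat)
  \<comment> \<open>The lower bound absorbs the constant \<open>n\<close> into
    \<open>n * cmod z\<close>, so that a factor \<open>cmod z\<close> can be cancelled from both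
    sides.\<close>
  also have "\<dots> \<le> (2 * real n + 1) * cmod z"
    using mult_left_mono[OF ge, of "real n"] by (simp add: algebra_simps)
  finally have "cmod z ^ n \<le> 2 * real n + 1"
    by (rule mult_right_le_imp_le) (use ge in linarith)
  \<comment> \<open>The gap is exactly \<open>n ^ 2\<close>, which is positive.\<close>
  also have "\<dots> < (real n + 1) ^ 2"
    using assms(1) by (simp add: power2_eq_square algebra_simps)
  also have "\<dots> = ((real n + 1) powr (2 / real n)) ^ n"
    using assms(1) by (simp add: powr_power)
  finally show ?thesis
    by (rule power_less_imp_less_base) simp
qed

theorem mainTheorem4:
  shows "(\<forall>n::nat. \<forall>z::complex. n \<ge> 2 \<longrightarrow> complex_root (f1 n) z \<longrightarrow>
            1 \<le> cmod z \<and> cmod z < (real n + 1) powr (2 / real n))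
       \<and> (\<forall>\<alpha>::nat \<Rightarrow> complex. (\<forall>n\<ge>2. complex_root (f1 n) (\<alpha> n)) \<longrightarrow>
            (\<lambda>n. cmod (\<alpha> n)) \<longlonglongrightarrow> 1)"
proof (intro conjI allI impI)
  fix n :: nat and z
  assume "n \<ge> 2" and root: "complex_root (f1 n) z"
  then have "n \<ge> 1" by simp
  from cmod_f1_root_ge_1[OF this root] show "1 \<le> cmod z" .
  from cmod_f1_root_less[OF \<open>n \<ge> 1\<close> root] show "cmod z < (real n + 1) powr (2 / real n)" .
next
  fix \<alpha> :: "nat \<Rightarrow> complex"
  assume root: "\<forall>n\<ge>2. complex_root (f1 n) (\<alpha> n)"
  have bounds: "1 \<le> cmod (\<alpha> n)" "cmod (\<alpha> n) \<le> (real n + 1) powr (2 / real n)" if "n \<ge> 2" for n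
    using cmod_f1_root_ge_1[of n "\<alpha> n"] cmod_f1_root_less[of n "\<alpha> n"] root that by force+
  \<comment> \<open>The logarithm \<open>2 * ln (n + 1) / n\<close> tends to 0.\<close>
  have lim: "(\<lambda>n. (real n + 1) powr (2 / real n)) \<longlonglongrightarrow> 1"
    by real_asymp
  show "(\<lambda>n. cmod (\<alpha> n)) \<longlonglongrightarrow> 1"
  \<comment> \<open>Eventual bounds suffice, so the unconstrained values of \<alpha> at 0 and 1 do
    no harm.\<close>
  proof (rule tendsto_sandwich[OF _ _ tendsto_const lim])
    show "\<forall>\<^sub>F n in sequentially. 1 \<le> cmod (\<alpha> n)"
      by (rule eventually_sequentiallyI) (rule bounds(1))
    show "\<forall>\<^sub>F n in sequentially. cmod (\<alpha> n) \<le> (real n + 1) powr (2 / real n)"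
      by (rule eventually_sequentiallyI) (rule bounds(2))
  qed
qed

end
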